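(* For every integer $n\ge 3$, \[E_3(n) = \frac{n^n}{\left(\frac{n-1}{2} - \frac{n+1}{2\sqrt{-3}}\right)\left(n - \frac{1}{2} + \frac{\sqrt{-3}}{2}\right)^{n-1} + \left(\frac{n-1}{2} + \frac{n+1}{2\sqrt{-3}}\right)\left(n - \frac{1}{2} - \frac{\sqrt{-3}}{2}\right)^{n-1}},\] where $\sqrt{-3}=i\sqrt 3$ and $E_3(n)$ is the expected number of rolls of a fair $n$-sided die until three consecutive (strictly) increasing values are seen.
   Context: $E_3(n)$: let $X_1,X_2,\dots$ be i.i.d. uniform on $\{1,\dots,n\}$ and let $T$ be the least $t\ge 3$ with $X_{t-2}<X_{t-1}<X_t$; then $E_3(n)=\mathbb{E}[T]$. *)

theory Defs
  imports "HOL-Probability.Probability"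
begin

text \<open>The rolls are indexed from 1; \<open>X 0\<close> is unconstrained and never used.\<close>

definition iid_die_rolls :: "'a measure \<Rightarrow> (nat \<Rightarrow> 'a \<Rightarrow> nat) \<Rightarrow> nat \<Rightarrow> bool" where
  "iid_die_rolls M X n \<longleftrightarrow>
     prob_space M \<and>
     prob_space.indep_vars M (\<lambda>_. count_space UNIV) X {1..} \<and>
     (\<forall>i\<ge>1. distr M (count_space UNIV) (X i) = measure_pmf (pmf_of_set {1..n}))"

text \<open>The infimum in \<^typ>\<open>enat\<close> is the least such \<open>t\<close>, and \<open>\<infinity>\<close> if there is none.\<close>

definition increasing3_time :: "(nat \<Rightarrow> 'a \<Rightarrow> nat) \<Rightarrow> 'a \<Rightarrow> enat" where
  "increasing3_time X \<omega> =
     (INF t\<in>{t. t \<ge> 3 \<and> X (t - 2) \<omega> < X (t - 1) \<omega> \<and> X (t - 1) \<omega> < X t \<omega>}. enat t)"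

definition E3 :: "'a measure \<Rightarrow> (nat \<Rightarrow> 'a \<Rightarrow> nat) \<Rightarrow> ennreal" where
  "E3 M X = (\<integral>\<^sup>+ \<omega>. ennreal_of_enat (increasing3_time X \<omega>) \<partial>M)"

definition sqrt_neg3 :: complex where
  "sqrt_neg3 = \<i> * complex_of_real (sqrt 3)"

end

theory Submission
  imports Defs
begin

text \<open>
  Call a sequence of rolls good up to time \<open>t\<close> if it has no three consecutive increasing values
  among the first \<open>t\<close>, let \<open>p t\<close> be the probability of this, and let
  \<open>q k = (n choose k) / n ^ k\<close> be the probability that \<open>k\<close> given consecutive rolls increase. Then
  \<open>E = (\<Sum>t. p t)\<close> is the expected waiting time, and the point is to invert this series.

  Cut the first \<open>m\<close> rolls into a prefix of length \<open>m - k\<close> that is good and a suffix of length \<open>k\<close>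
  that increases. For a fixed sequence of \<open>m \<ge> 1\<close> rolls, the admissible \<open>k\<close> form the empty set, the
  set \<open>{0, 1}\<close>, or three consecutive numbers. In each case the signs \<open>s k = 1, -1, 0\<close>
  (repeating with period three) of the admissible \<open>k\<close> add up to \<open>0\<close>: this is
  \<open>sum_trisign_splits_eq_0\<close>. Prefix and suffix are independent, so taking expectations gives
  \<open>(\<Sum>k\<le>m. s k * q k * p (m - k)) = 0\<close> for \<open>m \<ge> 1\<close>, while the sum is \<open>1\<close> for \<open>m = 0\<close>
  (\<open>survival_convolution\<close>). A convolution of two sequences that equals the unit sequence means that
  their sums are reciprocal, so \<open>E * (\<Sum>k. s k * q k) = 1\<close>. The series for \<open>E\<close> converges because
  each further block of three rolls increases with the fixed positive probability \<open>q 3\<close>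
  (\<open>survival_decay\<close>).

  Finally, \<open>s k = \<alpha> * w ^ k + \<alpha>' * w' ^ k\<close> for the two primitive cube roots of unity \<open>w\<close>, \<open>w'\<close>, so
  the binomial theorem evaluates \<open>n ^ n * (\<Sum>k. s k * q k)\<close> as
  \<open>\<alpha> * (n + w) ^ n + \<alpha>' * (n + w') ^ n\<close>. Multiplying one factor \<open>n + w\<close> into \<open>\<alpha>\<close>, and one factor
  \<open>n + w'\<close> into \<open>\<alpha>'\<close>, gives the coefficients and the exponents \<open>n - 1\<close> of the stated formula.
\<close>

section \<open>Increasing runs and the alternating sum\<close>

text \<open>The block consists of the \<open>k\<close> values that follow the first \<open>t\<close> ones. The step from \<open>x t\<close> to
  \<open>x (t + 1)\<close> is left free, which keeps the block independent of the values before it.\<close>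

definition increasing_after :: "(nat \<Rightarrow> 'a::order) \<Rightarrow> nat \<Rightarrow> nat \<Rightarrow> bool" where
  "increasing_after x t k \<longleftrightarrow> (\<forall>i\<in>{t<..<t + k}. x i < x (Suc i))"

definition avoids_triple :: "(nat \<Rightarrow> 'a::order) \<Rightarrow> nat \<Rightarrow> bool" where
  "avoids_triple x t \<longleftrightarrow> (\<forall>u\<in>{3..t}. \<not> (x (u - 2) < x (u - 1) \<and> x (u - 1) < x u))"

text \<open>These are the coefficients of \<open>1 / (1 + z + z\<^sup>2)\<close>.\<close>

definition trisign :: "nat \<Rightarrow> real" where
  "trisign k = (if k mod 3 = 0 then 1 else if k mod 3 = 1 then -1 else 0)"

lemma avoids_triple_cong:
  assumes "\<And>i. i \<in> {1..t} \<Longrightarrow> x i = y i"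
  shows "avoids_triple x t = avoids_triple y t"
proof -
  have "x (u - 2) = y (u - 2)" "x (u - 1) = y (u - 1)" "x u = y u" if "u \<in> {3..t}" for u
    using that by (auto intro!: assms)
  then show ?thesis by (simp add: avoids_triple_def)
qed

lemma increasing_after_cong:
  "(\<And>i. i \<in> {t<..t + k} \<Longrightarrow> x i = y i) \<Longrightarrow> increasing_after x t k = increasing_after y t k"
  by (simp add: increasing_after_def)

lemma increasing_afterD: "increasing_after x t k \<Longrightarrow> t < i \<Longrightarrow> i < t + k \<Longrightarrow> x i < x (Suc i)"
  by (simp add: increasing_after_def)

lemma trisign_three_consecutive: "trisign j + trisign (j + 1) + trisign (j + 2) = 0"
proof -
  have "j mod 3 = 0 \<or> j mod 3 = 1 \<or> j mod 3 = 2" by auto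
  then show ?thesis
  proof (elim disjE)
    assume "j mod 3 = 0"
    then have "(j + 1) mod 3 = 1" "(j + 2) mod 3 = 2" by presburger+
    then show ?thesis using \<open>j mod 3 = 0\<close> by (simp add: trisign_def)
  next
    assume "j mod 3 = 1"
    then have "(j + 1) mod 3 = 2" "(j + 2) mod 3 = 0" by presburger+
    then show ?thesis using \<open>j mod 3 = 1\<close> by (simp add: trisign_def)
  next
    assume "j mod 3 = 2"
    then have "(j + 1) mod 3 = 0" "(j + 2) mod 3 = 1" by presburger+
    then show ?thesis using \<open>j mod 3 = 2\<close> by (simp add: trisign_def)
  qed
qed

text \<open>Let \<open>j\<close> be the least admissible suffix length. If \<open>j = 0\<close>, then all \<open>m\<close> values are good, and
  a suffix of length \<open>1\<close>, perhaps \<open>2\<close>, but never \<open>3\<close> increases. If \<open>j > 0\<close>, then the prefix of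
  length \<open>m - j\<close> is good and the next longer one is not. So the first increasing triple ends exactly
  at \<open>T = m - j + 1\<close>, where the suffix starts. The suffix extends to the left by the two other members
  of that triple, and not by a third value, since this would complete an earlier triple.\<close>

lemma sum_trisign_splits_eq_0:
  fixes x :: "nat \<Rightarrow> 'a::order"
  assumes "m \<ge> 1"
  shows "(\<Sum>k | k \<le> m \<and> avoids_triple x (m - k) \<and> increasing_after x (m - k) k. trisign k) = 0"
    (is "sum _ ?S = 0")
proof -
  define S where "S = ?S"
  have S_iff: "k \<in> S \<longleftrightarrow> k \<le> m \<and> avoids_triple x (m - k) \<and> increasing_after x (m - k) k" for k
    by (simp add: S_def)
  have "sum trisign S = 0"
  proof (cases "S = {}")
    case False
    define j where "j = (LEAST k. k \<in> S)"
    have jS: "j \<in> S"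
    proof -
      have "\<exists>k. k \<in> S" using False by blast
      then show ?thesis unfolding j_def by (rule LeastI_ex)
    qed
    have j_le: "j \<le> k" if "k \<in> S" for k
      unfolding j_def using that by (rule Least_le)
    have avoids_mono: "avoids_triple x s" if "avoids_triple x t" "s \<le> t" for s t
      using that by (auto simp: avoids_triple_def)
    have above: "k \<in> S \<longleftrightarrow> k \<le> m \<and> increasing_after x (m - k) k" if "k \<ge> j" for k
      using jS avoids_mono[of "m - j" "m - k"] that by (auto simp: S_iff)
    have shorter: "increasing_after x (m - l) l"
      if "increasing_after x (m - k) k" "l \<le> k" "k \<le> m" for k l
      using that by (auto simp: increasing_after_def)
    have "S = {j, j + 1, j + 2} \<or> j = 0 \<and> S = {0, 1}"
    proof (cases "j = 0")
      case True
      then have av: "avoids_triple x m" using jS by (simp add: S_iff)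
      have one: "1 \<in> S"
        using above[of 1] assms True by (auto simp: increasing_after_def)
      have "\<not> increasing_after x (m - 3) 3" if "m \<ge> 3"
      proof
        assume inc: "increasing_after x (m - 3) 3"
        have "x (m - 2) < x (Suc (m - 2))" "x (m - 1) < x (Suc (m - 1))"
          by (rule increasing_afterD[OF inc]; use that in simp)+
        moreover have "Suc (m - 2) = m - 1" "Suc (m - 1) = m" using that by auto
        ultimately show False
          using av that unfolding avoids_triple_def by auto
      qed
      then have "k \<le> 2" if "k \<in> S" for k
        using that shorter[of k 3] by (cases "k \<ge> 3") (auto simp: S_iff)
      then have sub: "S \<subseteq> {0, 1, 2}" by fastforce
      show ?thesis
      proof (cases "2 \<in> S")
        case True
        with sub one jS \<open>j = 0\<close> have "S = {0, 1, 2}" by blast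
        then show ?thesis using \<open>j = 0\<close> by (simp add: numeral_2_eq_2)
      next
        case False
        with sub one jS \<open>j = 0\<close> have "S = {0, 1}" by blast
        then show ?thesis using \<open>j = 0\<close> by simp
      qed
    next
      case False
      define T where "T = m - j + 1"
      have jm: "j \<le> m" and inc: "increasing_after x (m - j) j" and av: "avoids_triple x (m - j)"
        using jS by (auto simp: S_iff)
      have mT: "m - (j - 1) = T" using False jm by (simp add: T_def)
      have "j - 1 \<notin> S" using j_le[of "j - 1"] False by auto
      moreover have "increasing_after x (m - (j - 1)) (j - 1)"
        using shorter[OF inc] jm by simp
      ultimately have "\<not> avoids_triple x T"
        using jm mT by (auto simp: S_iff)
      then obtain u where u: "3 \<le> u" "u \<le> T" "x (u - 2) < x (u - 1)" "x (u - 1) < x u"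
        by (auto simp: avoids_triple_def)
      have "u = T"
      proof (rule ccontr)
        assume "u \<noteq> T"
        then have "u \<in> {3..m - j}" using u by (auto simp: T_def)
        then show False using av u(3,4) unfolding avoids_triple_def by blast
      qed
      with u have T: "3 \<le> T" "x (T - 2) < x (T - 1)" "x (T - 1) < x T" by auto
      have T_eqs: "m - (j + 1) = T - 2" "m - (j + 2) = T - 3" "m - j = T - 1"
        "j + 2 \<le> m" "T + j = m + 1"
        using T(1) jm by (auto simp: T_def)
      have two: "j + 2 \<in> S"
      proof -
        have "increasing_after x (T - 3) (j + 2)"
          unfolding increasing_after_def
        proof
          fix i assume "i \<in> {T - 3<..<T - 3 + (j + 2)}"
          then have i: "T - 3 < i" "i < T - 3 + (j + 2)" by auto
          have "i = T - 2 \<or> i = T - 1 \<or> T \<le> i" using i(1) T(1) by linarith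
          moreover have "m - j < i \<and> i < m - j + j" if "T \<le> i"
            using that i(2) T(1) T_eqs(3) by linarith
          ultimately consider "i = T - 2" | "i = T - 1" | "i > m - j" "i < m - j + j"
            by blast
          then show "x i < x (Suc i)"
          proof cases
            case 1
            moreover have "Suc (T - 2) = T - 1" using T(1) by simp
            ultimately show ?thesis using T(2) by simp
          next
            case 2
            then show ?thesis using T(1,3) by simp
          next
            case 3
            then show ?thesis using inc by (auto simp: increasing_after_def)
          qed
        qed
        then show ?thesis using above[of "j + 2"] T_eqs by simp
      qed
      have one: "j + 1 \<in> S"
        using two above[of "j + 1"] shorter[of "j + 2" "j + 1"] by (auto simp: S_iff)
      have "\<not> increasing_after x (m - (j + 3)) (j + 3)" if "j + 3 \<le> m"
      proof
        assume inc3: "increasing_after x (m - (j + 3)) (j + 3)"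
        have "x (T - 3) < x (Suc (T - 3))"
          by (rule increasing_afterD[OF inc3]) (use that T_eqs in auto)
        moreover have "Suc (T - 3) = T - 1 - 1" "T - 3 = T - 1 - 2" using T(1) by auto
        moreover have "T - 1 \<in> {3..m - j}" using that T_eqs by auto
        moreover have "T - 2 = T - 1 - 1" by simp
        ultimately show False
          using av T(2) unfolding avoids_triple_def by metis
      qed
      then have "k \<le> j + 2" if "k \<in> S" for k
        using that shorter[of k "j + 3"] by (cases "k \<ge> j + 3") (auto simp: S_iff)
      with j_le have "k \<in> {j, j + 1, j + 2}" if "k \<in> S" for k
        using that by force
      with jS one two have "S = {j, j + 1, j + 2}" by blast
      then show ?thesis by blast
    qed
    then show ?thesis
    proof
      assume S: "S = {j, j + 1, j + 2}"
      show ?thesis unfolding S using trisign_three_consecutive[of j] by simp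
    next
      assume S: "j = 0 \<and> S = {0, 1}"
      have "sum trisign {0, 1} = 0" by (simp add: trisign_def)
      then show ?thesis using S by simp
    qed
  qed simp
  then show ?thesis by (simp add: S_def)
qed

section \<open>Independent blocks of rolls\<close>

locale die_rolls = prob_space M for M :: "'a measure" +
  fixes X :: "nat \<Rightarrow> 'a \<Rightarrow> nat" and n :: nat
  assumes indep: "indep_vars (\<lambda>_. count_space UNIV) X {1..}"
    and uniform: "\<And>i. i \<ge> 1 \<Longrightarrow>
      distr M (count_space UNIV) (X i) = measure_pmf (pmf_of_set {1..n})"
    and sides: "n \<ge> 1"
begin

abbreviation seq :: "'a \<Rightarrow> nat \<Rightarrow> nat" where
  "seq \<omega> \<equiv> \<lambda>i. X i \<omega>"

lemma measurable_roll [measurable]: "i \<ge> 1 \<Longrightarrow> X i \<in> measurable M (count_space UNIV)"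
  using indep by (auto simp: indep_vars_def)

text \<open>Every subset of a finite product of countable discrete spaces is measurable, so it is enough
  that the condition depends on finitely many rolls.\<close>

lemma measurable_finite_block:
  assumes "finite A" "A \<subseteq> {1..}"
    and dep: "\<And>x y. (\<And>i. i \<in> A \<Longrightarrow> x i = y i) \<Longrightarrow> P x = P y"
  shows "{\<omega> \<in> space M. P (seq \<omega>)} \<in> sets M"
proof -
  have PiM: "PiM A (\<lambda>_. count_space (UNIV :: nat set)) = count_space (PiE A (\<lambda>_. UNIV))"
    by (rule count_space_PiM_finite) (use assms in auto)
  have "(\<lambda>\<omega>. restrict (seq \<omega>) A) \<in> measurable M (PiM A (\<lambda>_. count_space UNIV))"
    using assms(2) by (intro measurable_restrict measurable_roll) auto
  then have "(\<lambda>\<omega>. restrict (seq \<omega>) A) \<in> measurable M (count_space (PiE A (\<lambda>_. UNIV)))"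
    by (simp add: PiM)
  then have "(\<lambda>\<omega>. restrict (seq \<omega>) A) -` {f \<in> PiE A (\<lambda>_. UNIV). P f} \<inter> space M \<in> sets M"
    by (rule measurable_sets) auto
  also have "(\<lambda>\<omega>. restrict (seq \<omega>) A) -` {f \<in> PiE A (\<lambda>_. UNIV). P f} \<inter> space M =
      {\<omega> \<in> space M. P (seq \<omega>)}"
    using dep[of "restrict (seq _) A" "seq _"] by auto
  finally show ?thesis .
qed

lemma prob_disjoint_blocks:
  assumes "finite A" "finite B" "A \<inter> B = {}" "A \<subseteq> {1..}" "B \<subseteq> {1..}"
    and P: "\<And>x y. (\<And>i. i \<in> A \<Longrightarrow> x i = y i) \<Longrightarrow> P x = P y"
    and Q: "\<And>x y. (\<And>i. i \<in> B \<Longrightarrow> x i = y i) \<Longrightarrow> Q x = Q y"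
  shows "prob {\<omega> \<in> space M. P (seq \<omega>) \<and> Q (seq \<omega>)} =
    prob {\<omega> \<in> space M. P (seq \<omega>)} * prob {\<omega> \<in> space M. Q (seq \<omega>)}"
proof -
  let ?N = "\<lambda>A. PiM A (\<lambda>_. count_space (UNIV :: nat set))"
  let ?R = "\<lambda>A \<omega>. restrict (seq \<omega>) A"
  have PiM: "?N A = count_space (PiE A (\<lambda>_. UNIV))" if "finite A" for A :: "nat set"
    by (rule count_space_PiM_finite) (use that in auto)
  have "indep_var (?N A) (?R A) (?N B) (?R B)"
    by (rule indep_var_restrict[OF indep]) (use assms in auto)
  then have "prob ((\<lambda>\<omega>. (?R A \<omega>, ?R B \<omega>)) -`
        ({f \<in> PiE A (\<lambda>_. UNIV). P f} \<times> {f \<in> PiE B (\<lambda>_. UNIV). Q f}) \<inter> space M) =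
      prob (?R A -` {f \<in> PiE A (\<lambda>_. UNIV). P f} \<inter> space M) *
      prob (?R B -` {f \<in> PiE B (\<lambda>_. UNIV). Q f} \<inter> space M)"
    by (rule indep_varD) (auto simp: PiM assms(1,2))
  moreover have "P (?R A \<omega>) = P (seq \<omega>)" "Q (?R B \<omega>) = Q (seq \<omega>)" for \<omega>
    by (rule P, simp) (rule Q, simp)
  then have "(\<lambda>\<omega>. (?R A \<omega>, ?R B \<omega>)) -`
        ({f \<in> PiE A (\<lambda>_. UNIV). P f} \<times> {f \<in> PiE B (\<lambda>_. UNIV). Q f}) \<inter> space M =
      {\<omega> \<in> space M. P (seq \<omega>) \<and> Q (seq \<omega>)}"
    "?R A -` {f \<in> PiE A (\<lambda>_. UNIV). P f} \<inter> space M = {\<omega> \<in> space M. P (seq \<omega>)}"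
    "?R B -` {f \<in> PiE B (\<lambda>_. UNIV). Q f} \<inter> space M = {\<omega> \<in> space M. Q (seq \<omega>)}"
    by auto
  ultimately show ?thesis by simp
qed

lemma prob_roll: "i \<ge> 1 \<Longrightarrow> j \<in> {1..n} \<Longrightarrow> prob {\<omega> \<in> space M. X i \<omega> = j} = 1 / n"
proof -
  assume i: "i \<ge> 1" and j: "j \<in> {1..n}"
  have "prob {\<omega> \<in> space M. X i \<omega> = j} = measure (distr M (count_space UNIV) (X i)) {j}"
    using i by (subst measure_distr) (auto intro!: arg_cong[where f = prob])
  also have "\<dots> = 1 / n"
    unfolding uniform[OF i] using j sides by (simp add: measure_pmf_single)
  finally show ?thesis .
qed

lemma AE_roll: "i \<ge> 1 \<Longrightarrow> AE \<omega> in M. X i \<omega> \<in> {1..n}"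
proof -
  assume i: "i \<ge> 1"
  have "AE y in distr M (count_space UNIV) (X i). y \<in> {1..n}"
    unfolding uniform[OF i] using sides by (simp add: AE_measure_pmf_iff)
  then show ?thesis
    using i by (subst (asm) AE_distr_iff) auto
qed

lemma sets_increasing_bounded:
  "{\<omega> \<in> space M. increasing_after (seq \<omega>) t k \<and> (\<forall>i\<in>{t<..t + k}. X i \<omega> \<le> j)} \<in> sets M"
  by (rule measurable_finite_block[of "{t<..t + k}"]) (auto simp: increasing_after_def)

text \<open>The probabilities obey Pascal's rule in the upper bound \<open>j\<close>: if \<open>l + 1\<close> increasing values are
  at most \<open>j + 1\<close>, then either all are at most \<open>j\<close>, or the last one is \<open>j + 1\<close> and the others are
  at most \<open>j\<close>. The last value is independent of the others, and each of its values costs a factor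
  \<open>1 / n\<close>.\<close>

lemma prob_increasing_bounded:
  "j \<le> n \<Longrightarrow> prob {\<omega> \<in> space M. increasing_after (seq \<omega>) t k \<and> (\<forall>i\<in>{t<..t + k}. X i \<omega> \<le> j)}
     = (j choose k) / n ^ k"
proof (induction j arbitrary: k)
  case 0
  show ?case
  proof (cases k)
    case 0
    then show ?thesis by (simp add: increasing_after_def prob_space)
  next
    case (Suc l)
    have "AE \<omega> in M. X (t + 1) \<omega> \<in> {1..n}" by (rule AE_roll) simp
    then have "AE \<omega> in M. \<omega> \<notin> {\<omega> \<in> space M. increasing_after (seq \<omega>) t k \<and> (\<forall>i\<in>{t<..t + k}. X i \<omega> \<le> 0)}"
      by eventually_elim (auto simp: Suc intro!: bexI[of _ "t + 1"])
    then have "prob {\<omega> \<in> space M. increasing_after (seq \<omega>) t k \<and> (\<forall>i\<in>{t<..t + k}. X i \<omega> \<le> 0)} = 0"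
      by (subst prob_eq_0[OF sets_increasing_bounded])
    then show ?thesis by (simp add: Suc)
  qed
next
  case (Suc j)
  let ?E = "\<lambda>k j x. increasing_after x t k \<and> (\<forall>i\<in>{t<..t + k}. x i \<le> j)"
  show ?case
  proof (cases k)
    case 0
    then show ?thesis by (simp add: increasing_after_def prob_space)
  next
    case (Suc l)
    have split: "?E (Suc l) (Suc j) x \<longleftrightarrow> ?E (Suc l) j x \<or> (?E l j x \<and> x (t + Suc l) = Suc j)"
      for x :: "nat \<Rightarrow> nat"
    proof
      assume E: "?E (Suc l) (Suc j) x"
      then have step: "x i < x (Suc i)" if "t < i" "i < t + Suc l" for i
        using that by (auto simp: increasing_after_def)
      have last: "x i < x (t + Suc l)" if "t < i" "i < t + Suc l" for i
      proof -
        have "x i < x k" if "i < k" "k \<le> t + Suc l" for k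
          using that
        proof (induction k)
          case (Suc k)
          then show ?case using step[of k] \<open>t < i\<close> by (cases "i = k") auto
        qed simp
        then show ?thesis using that by auto
      qed
      show "?E (Suc l) j x \<or> (?E l j x \<and> x (t + Suc l) = Suc j)"
      proof (cases "x (t + Suc l) = Suc j")
        case True
        have "?E l j x" using E last True by (fastforce simp: increasing_after_def)
        with True show ?thesis by simp
      next
        case False
        moreover have "x (t + Suc l) \<le> Suc j" using E by simp
        ultimately have le: "x (t + Suc l) \<le> j" by simp
        have "x i \<le> j" if "i \<in> {t<..t + Suc l}" for i
          using last[of i] le that by (cases "i = t + Suc l") auto
        with E show ?thesis by auto
      qed
    next
      assume "?E (Suc l) j x \<or> (?E l j x \<and> x (t + Suc l) = Suc j)"
      then show "?E (Suc l) (Suc j) x"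
      proof
        assume E: "?E l j x \<and> x (t + Suc l) = Suc j"
        have "x i < x (Suc i)" if "i \<in> {t<..<t + Suc l}" for i
        proof (cases "i = t + l")
          case True
          then have "x i \<le> j" using E that by auto
          then show ?thesis using E True by simp
        next
          case False
          then show ?thesis using E that by (auto simp: increasing_after_def)
        qed
        moreover have "x i \<le> Suc j" if "i \<in> {t<..t + Suc l}" for i
          using E that by (cases "i = t + Suc l") (auto simp: le_SucI)
        ultimately show ?thesis by (simp add: increasing_after_def)
      qed (auto simp: le_SucI)
    qed
    have "prob {\<omega> \<in> space M. ?E (Suc l) (Suc j) (seq \<omega>)} =
        prob ({\<omega> \<in> space M. ?E (Suc l) j (seq \<omega>)} \<union>
          {\<omega> \<in> space M. ?E l j (seq \<omega>) \<and> X (t + Suc l) \<omega> = Suc j})"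
      by (rule arg_cong[where f = prob], rule set_eqI, simp only: mem_Collect_eq Un_iff split) blast
    also have "\<dots> = prob {\<omega> \<in> space M. ?E (Suc l) j (seq \<omega>)} +
          prob {\<omega> \<in> space M. ?E l j (seq \<omega>) \<and> X (t + Suc l) \<omega> = Suc j}"
    proof (rule finite_measure_Union)
      show "{\<omega> \<in> space M. ?E l j (seq \<omega>) \<and> X (t + Suc l) \<omega> = Suc j} \<in> sets M"
        by (rule measurable_finite_block[of "{t<..t + Suc l}"]) (auto simp: increasing_after_def)
      show "{\<omega> \<in> space M. ?E (Suc l) j (seq \<omega>)} \<inter>
          {\<omega> \<in> space M. ?E l j (seq \<omega>) \<and> X (t + Suc l) \<omega> = Suc j} = {}"
        by (auto dest!: bspec[where x = "t + Suc l"])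
    qed (rule sets_increasing_bounded)
    also have "prob {\<omega> \<in> space M. ?E l j (seq \<omega>) \<and> X (t + Suc l) \<omega> = Suc j} =
        prob {\<omega> \<in> space M. ?E l j (seq \<omega>)} * prob {\<omega> \<in> space M. X (t + Suc l) \<omega> = Suc j}"
    proof (rule prob_disjoint_blocks[of "{t<..t + l}" "{t + Suc l}" "?E l j"
          "\<lambda>x. x (t + Suc l) = Suc j"])
      show "?E l j x = ?E l j y" if "\<And>i. i \<in> {t<..t + l} \<Longrightarrow> x i = y i" for x y
        using that by (simp add: increasing_after_def)
    qed auto
    also have "prob {\<omega> \<in> space M. X (t + Suc l) \<omega> = Suc j} = 1 / n"
      using Suc.prems by (intro prob_roll) auto
    also have "prob {\<omega> \<in> space M. ?E (Suc l) j (seq \<omega>)} = (j choose Suc l) / n ^ Suc l"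
      using Suc.prems by (intro Suc.IH) simp
    also have "prob {\<omega> \<in> space M. ?E l j (seq \<omega>)} = (j choose l) / n ^ l"
      using Suc.prems by (intro Suc.IH) simp
    also have "(j choose Suc l) / n ^ Suc l + (j choose l) / n ^ l * (1 / n) =
        (Suc j choose Suc l) / n ^ Suc l"
      by (simp add: add_divide_distrib)
    finally show ?thesis by (simp only: Suc)
  qed
qed

lemma prob_increasing:
  "prob {\<omega> \<in> space M. increasing_after (seq \<omega>) t k} = (n choose k) / n ^ k"
proof -
  have "AE \<omega> in M. \<forall>i\<in>{t<..t + k}. X i \<omega> \<in> {1..n}"
    by (rule AE_finite_allI, simp, rule AE_roll) simp
  then have "AE \<omega> in M. \<omega> \<in> {\<omega> \<in> space M. increasing_after (seq \<omega>) t k} \<longleftrightarrow>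
      \<omega> \<in> {\<omega> \<in> space M. increasing_after (seq \<omega>) t k \<and> (\<forall>i\<in>{t<..t + k}. X i \<omega> \<le> n)}"
    by eventually_elim auto
  then have "prob {\<omega> \<in> space M. increasing_after (seq \<omega>) t k} =
      prob {\<omega> \<in> space M. increasing_after (seq \<omega>) t k \<and> (\<forall>i\<in>{t<..t + k}. X i \<omega> \<le> n)}"
    by (rule finite_measure_eq_AE)
      (rule sets_increasing_bounded measurable_finite_block[of "{t<..t + k}"];
        auto simp: increasing_after_def)+
  then show ?thesis by (simp add: prob_increasing_bounded)
qed

section \<open>The expected waiting time\<close>

definition survival :: "nat \<Rightarrow> real" where
  "survival t = prob {\<omega> \<in> space M. avoids_triple (seq \<omega>) t}"

lemma survival_nonneg: "0 \<le> survival t"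
  by (simp add: survival_def)

lemma sets_avoids: "{\<omega> \<in> space M. avoids_triple (seq \<omega>) t} \<in> sets M"
  by (rule measurable_finite_block[of "{1..t}"]) (rule avoids_triple_cong | simp)+

lemma sets_avoids_increasing:
  "{\<omega> \<in> space M. avoids_triple (seq \<omega>) t \<and> increasing_after (seq \<omega>) t k} \<in> sets M"
  by (rule measurable_finite_block[of "{1..t + k}"])
    (rule arg_cong2[where f = "(\<and>)"] avoids_triple_cong increasing_after_cong | simp)+

lemma prob_avoids_increasing:
  "prob {\<omega> \<in> space M. avoids_triple (seq \<omega>) t \<and> increasing_after (seq \<omega>) t k} =
    survival t * ((n choose k) / n ^ k)"
  unfolding survival_def prob_increasing[of t k, symmetric]
  by (rule prob_disjoint_blocks[of "{1..t}" "{t<..t + k}"])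
    ((rule avoids_triple_cong increasing_after_cong, simp) | force)+

text \<open>By independence, each term is the signed probability that the split of the first \<open>m\<close> rolls into
  a prefix of length \<open>m - k\<close> and a suffix of length \<open>k\<close> is admissible. Their sum is the expectation of
  the signed count of admissible splits, which vanishes pointwise for \<open>m \<ge> 1\<close>.\<close>

lemma survival_convolution:
  "(\<Sum>k\<le>m. trisign k * ((n choose k) / n ^ k) * survival (m - k)) = (if m = 0 then 1 else 0)"
proof (cases "m = 0")
  case True
  then show ?thesis
    by (simp add: trisign_def survival_def avoids_triple_def prob_space)
next
  case False
  let ?B = "\<lambda>k. {\<omega> \<in> space M. avoids_triple (seq \<omega>) (m - k) \<and> increasing_after (seq \<omega>) (m - k) k}"
  have [measurable]: "?B k \<in> sets M" for k by (rule sets_avoids_increasing)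
  have "(\<Sum>k\<le>m. trisign k * ((n choose k) / n ^ k) * survival (m - k)) =
      (\<Sum>k\<le>m. trisign k * prob (?B k))"
    by (simp add: prob_avoids_increasing mult_ac)
  also have "\<dots> = (\<Sum>k\<le>m. expectation (\<lambda>\<omega>. trisign k * indicator (?B k) \<omega>))"
    by (intro sum.cong) (auto simp: emeasure_eq_measure intro!: arg_cong[where f = prob])
  also have "\<dots> = expectation (\<lambda>\<omega>. \<Sum>k\<le>m. trisign k * indicator (?B k) \<omega>)"
    by (subst Bochner_Integration.integral_sum) (auto simp: emeasure_eq_measure)
  also have "\<dots> = expectation (\<lambda>\<omega>. 0)"
  proof (rule Bochner_Integration.integral_cong[OF refl])
    fix \<omega> assume "\<omega> \<in> space M"
    then have "(\<Sum>k\<le>m. trisign k * indicator (?B k) \<omega>) =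
        (\<Sum>k\<in>{..m}. if avoids_triple (seq \<omega>) (m - k) \<and> increasing_after (seq \<omega>) (m - k) k
           then trisign k else 0)"
      by (intro sum.cong) (auto simp: indicator_def)
    also have "\<dots> = (\<Sum>k | k \<le> m \<and> avoids_triple (seq \<omega>) (m - k) \<and>
        increasing_after (seq \<omega>) (m - k) k. trisign k)"
      by (subst sum.inter_filter[symmetric]) (auto intro!: sum.cong)
    also have "\<dots> = 0" using False by (intro sum_trisign_splits_eq_0) simp
    finally show "(\<Sum>k\<le>m. trisign k * indicator (?B k) \<omega>) = 0" .
  qed
  finally show ?thesis using False by simp
qed

text \<open>Surviving until \<open>t + 3\<close> requires surviving until \<open>t\<close> and an independent block of three rolls that
  does not increase.\<close>

lemma survival_decay: "survival (t + 3) \<le> survival t * (1 - (n choose 3) / n ^ 3)"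
proof -
  let ?A = "{\<omega> \<in> space M. avoids_triple (seq \<omega>) t}"
  let ?B = "{\<omega> \<in> space M. avoids_triple (seq \<omega>) t \<and> increasing_after (seq \<omega>) t 3}"
  have "\<not> increasing_after x t 3" if av: "avoids_triple x (t + 3)" for x :: "nat \<Rightarrow> nat"
  proof
    assume inc: "increasing_after x t 3"
    have "x (t + 1) < x (Suc (t + 1))" "x (t + 2) < x (Suc (t + 2))"
      by (rule increasing_afterD[OF inc]; simp)+
    moreover have "\<not> (x (t + 3 - 2) < x (t + 3 - 1) \<and> x (t + 3 - 1) < x (t + 3))"
      using av unfolding avoids_triple_def by (rule bspec) simp
    ultimately show False by (simp add: numeral_3_eq_3)
  qed
  then have "{\<omega> \<in> space M. avoids_triple (seq \<omega>) (t + 3)} \<subseteq> ?A - ?B"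
    by (auto simp: avoids_triple_def)
  then have "survival (t + 3) \<le> prob (?A - ?B)"
    unfolding survival_def using sets_avoids sets_avoids_increasing
    by (intro finite_measure_mono) auto
  also have "\<dots> = prob ?A - prob ?B"
    using sets_avoids sets_avoids_increasing by (intro finite_measure_Diff) auto
  finally show ?thesis
    unfolding prob_avoids_increasing survival_def[symmetric] by (simp add: algebra_simps)
qed

lemma summable_survival:
  assumes "n \<ge> 3"
  shows "summable survival"
proof -
  define q where "q = real (n choose 3) / real (n ^ 3)"
  have q: "q > 0" using assms by (simp add: q_def)
  have p: "0 \<le> survival t" "survival t \<le> 1" for t
    by (simp_all add: survival_nonneg survival_def)
  \<comment> \<open>The decay reads \<open>q * survival t \<le> survival t - survival (t + 3)\<close>, whose right side telescopes.\<close>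
  have "q * (\<Sum>t<N. survival t) \<le> 3 - (survival N + survival (N + 1) + survival (N + 2))" for N
  proof (induction N)
    case 0
    show ?case using p(2)[of 0] p(2)[of 1] p(2)[of 2] by (simp add: numeral_2_eq_2)
  next
    case (Suc N)
    then show ?case
      using survival_decay[of N, folded q_def]
      by (simp add: algebra_simps numeral_3_eq_3)
  qed
  then have "q * (\<Sum>t<N. survival t) \<le> 3" for N
    using p(1)[of N] p(1)[of "N + 1"] p(1)[of "N + 2"] by (smt (verit))
  then have "(\<Sum>t<N. survival t) \<le> 3 / q" for N
    using q by (simp add: field_simps)
  then show ?thesis by (intro summableI_nonneg_bounded p(1))
qed

lemma suminf_survival:
  assumes "n \<ge> 3"
  shows "(\<Sum>k\<le>n. trisign k * (n choose k) / n ^ k) * suminf survival = 1"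
proof -
  let ?a = "\<lambda>k. trisign k * ((n choose k) / n ^ k)"
  have zero: "?a k = 0" if "k \<notin> {..n}" for k using that by simp
  have "(\<lambda>m. \<Sum>k\<le>m. ?a k * survival (m - k)) sums (suminf ?a * suminf survival)"
  proof (rule Cauchy_product_sums)
    show "summable (\<lambda>k. norm (?a k))"
      by (rule summable_finite[of "{..n}"]) (use zero in auto)
    show "summable (\<lambda>k. norm (survival k))"
      using summable_survival[OF assms] by (simp add: survival_nonneg)
  qed
  moreover have "(\<lambda>m. \<Sum>k\<le>m. ?a k * survival (m - k)) sums 1"
    unfolding survival_convolution using sums_single[of 0 "\<lambda>_. 1 :: real"] by simp
  ultimately have "suminf ?a * suminf survival = 1" by (rule sums_unique2)
  moreover have "suminf ?a = sum ?a {..n}" by (rule suminf_finite) (use zero in auto)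
  ultimately show ?thesis by simp
qed

lemma less_increasing3_time_iff: "enat t < increasing3_time X \<omega> \<longleftrightarrow> avoids_triple (seq \<omega>) t"
proof -
  let ?H = "{u. u \<ge> 3 \<and> X (u - 2) \<omega> < X (u - 1) \<omega> \<and> X (u - 1) \<omega> < X u \<omega>}"
  have "enat t < increasing3_time X \<omega> \<longleftrightarrow> (\<forall>u\<in>?H. t < u)"
  proof
    assume "enat t < increasing3_time X \<omega>"
    then have "enat t < enat u" if "u \<in> ?H" for u
      unfolding increasing3_time_def using that by (rule less_INF_D)
    then show "\<forall>u\<in>?H. t < u" by simp
  next
    assume *: "\<forall>u\<in>?H. t < u"
    have "enat (Suc t) \<le> increasing3_time X \<omega>"
      unfolding increasing3_time_def
    proof (rule INF_greatest)
      fix u assume "u \<in> ?H"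
      with * have "t < u" by blast
      then show "enat (Suc t) \<le> enat u" by simp
    qed
    then show "enat t < increasing3_time X \<omega>" by (simp add: Suc_ile_eq)
  qed
  also have "\<dots> \<longleftrightarrow> avoids_triple (seq \<omega>) t"
    unfolding avoids_triple_def by (simp add: Ball_def) (meson not_le)
  finally show ?thesis .
qed

lemma measurable_increasing3_time: "increasing3_time X \<in> measurable M (count_space UNIV)"
proof -
  let ?T = "increasing3_time X"
  have gt: "{\<omega> \<in> space M. enat t < ?T \<omega>} \<in> sets M" for t
    unfolding less_increasing3_time_iff by (rule sets_avoids)
  have "?T -` {a} \<inter> space M \<in> sets M" for a
  proof (cases a)
    case (enat t)
    have "?T -` {a} \<inter> space M =
      (if t = 0 then space M else {\<omega> \<in> space M. enat (t - 1) < ?T \<omega>}) - {\<omega> \<in> space M. enat t < ?T \<omega>}"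
      (is "?l = ?r")
    proof (rule set_eqI)
      fix \<omega> show "\<omega> \<in> ?l \<longleftrightarrow> \<omega> \<in> ?r"
        using enat by (cases "?T \<omega>") auto
    qed
    then show ?thesis using gt by auto
  next
    case infinity
    have "?T -` {a} \<inter> space M = (\<Inter>t. {\<omega> \<in> space M. enat t < ?T \<omega>})" (is "?l = ?r")
    proof (rule set_eqI)
      fix \<omega> show "\<omega> \<in> ?l \<longleftrightarrow> \<omega> \<in> ?r"
        using infinity by (cases "?T \<omega>") auto
    qed
    then show ?thesis using gt by auto
  qed
  then show ?thesis by (simp add: measurable_count_space_eq2_countable)
qed

text \<open>The expectation of a time is the sum of its tail probabilities.\<close>

lemma E3_eq_suminf_survival:
  assumes "n \<ge> 3"
  shows "E3 M X = ennreal (suminf survival)"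
proof -
  have "E3 M X = (\<Sum>t. emeasure M {\<omega> \<in> space M. enat t < increasing3_time X \<omega>})"
    unfolding E3_def by (rule nn_integral_enat_function[OF measurable_increasing3_time])
  also have "\<dots> = (\<Sum>t. ennreal (survival t))"
    by (simp add: less_increasing3_time_iff survival_def emeasure_eq_measure)
  also have "\<dots> = ennreal (suminf survival)"
    by (rule suminf_ennreal2[OF survival_nonneg summable_survival[OF assms]])
  finally show ?thesis .
qed

end

section \<open>The closed form\<close>

lemma sqrt_neg3_square: "sqrt_neg3 * sqrt_neg3 = -3"
  by (simp add: sqrt_neg3_def complex_eq_iff)

text \<open>Both sides have period three because the bases are cube roots of unity, so three values decide.
  The coefficients are the solution of the linear system for \<open>k = 0\<close> and \<open>k = 1\<close>; as
  \<open>1 / \<surd>-3 = - \<surd>-3 / 3\<close>, the first is \<open>1 / 2 - 1 / (2 * \<surd>-3)\<close>.\<close>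

lemma trisign_eq_roots_of_unity:
  "complex_of_real (trisign k) =
     (1 / 2 + sqrt_neg3 / 6) * ((- 1 + sqrt_neg3) / 2) ^ k
   + (1 / 2 - sqrt_neg3 / 6) * ((- 1 - sqrt_neg3) / 2) ^ k"
proof (induction k rule: less_induct)
  case (less k)
  have cubes: "((sqrt_neg3 - 1) / 2) ^ 3 = 1" "((- 1 - sqrt_neg3) / 2) ^ 3 = 1"
    using sqrt_neg3_square by (simp_all add: field_simps power3_eq_cube) algebra+
  have "k = 0 \<or> k = 1 \<or> k = 2 \<or> k = (k - 3) + 3" by linarith
  then consider "k = 0" | "k = 1" | "k = 2" | l where "k = l + 3" by blast
  then show ?case
  proof cases
    case 4
    have "trisign k = trisign l" by (simp add: 4 trisign_def)
    then show ?thesis using less[of l] by (simp add: 4 power_add cubes del: of_real_eq_iff)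
  qed (use sqrt_neg3_square in \<open>simp_all add: trisign_def field_simps power2_eq_square\<close>)
qed

lemma trisign_binomial_sum:
  fixes n :: nat
  assumes "n \<ge> 1"
  shows "of_nat n ^ n * complex_of_real (\<Sum>k\<le>n. trisign k * (n choose k) / n ^ k) =
        ((of_nat n - 1) / 2 - (of_nat n + 1) / (2 * sqrt_neg3))
            * (of_nat n - 1 / 2 + sqrt_neg3 / 2) ^ (n - 1)
         + ((of_nat n - 1) / 2 + (of_nat n + 1) / (2 * sqrt_neg3))
            * (of_nat n - 1 / 2 - sqrt_neg3 / 2) ^ (n - 1)"
proof -
  let ?s = sqrt_neg3
  let ?N = "of_nat n :: complex"
  have s0: "?s \<noteq> 0" using sqrt_neg3_square by auto
  have binom: "(\<Sum>k\<le>n. c * w ^ k * of_nat (n choose k) * ?N ^ (n - k)) = c * (?N + w) ^ n" for c w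
    by (simp add: binomial_ring[of w ?N n] add.commute[of ?N w] sum_distrib_left mult_ac)
  have "?N ^ n * complex_of_real (\<Sum>k\<le>n. trisign k * (n choose k) / n ^ k) =
      (\<Sum>k\<le>n. of_real (trisign k) * of_nat (n choose k) * ?N ^ (n - k))"
    unfolding of_real_sum sum_distrib_left
    using assms by (intro sum.cong) (auto simp: power_diff field_simps)
  also have "\<dots> = (1 / 2 + ?s / 6) * (?N + (- 1 + ?s) / 2) ^ n + (1 / 2 - ?s / 6) * (?N + (- 1 - ?s) / 2) ^ n"
    unfolding trisign_eq_roots_of_unity binom[symmetric] sum.distrib[symmetric]
    by (intro sum.cong) (auto simp: algebra_simps)
  also have "?N + (- 1 + ?s) / 2 = ?N - 1 / 2 + ?s / 2" by (simp add: field_simps)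
  also have "?N + (- 1 - ?s) / 2 = ?N - 1 / 2 - ?s / 2" by (simp add: field_simps)
  also have "(1 / 2 + ?s / 6) * (?N - 1 / 2 + ?s / 2) ^ n =
      ((1 / 2 + ?s / 6) * (?N - 1 / 2 + ?s / 2)) * (?N - 1 / 2 + ?s / 2) ^ (n - 1)"
    using assms by (cases n) auto
  also have "(1 / 2 - ?s / 6) * (?N - 1 / 2 - ?s / 2) ^ n =
      ((1 / 2 - ?s / 6) * (?N - 1 / 2 - ?s / 2)) * (?N - 1 / 2 - ?s / 2) ^ (n - 1)"
    using assms by (cases n) auto
  also have "(1 / 2 + ?s / 6) * (?N - 1 / 2 + ?s / 2) = (?N - 1) / 2 - (?N + 1) / (2 * ?s)"
    using s0 sqrt_neg3_square by (simp add: field_simps) algebra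
  also have "(1 / 2 - ?s / 6) * (?N - 1 / 2 - ?s / 2) = (?N - 1) / 2 + (?N + 1) / (2 * ?s)"
    using s0 sqrt_neg3_square by (simp add: field_simps) algebra
  finally show ?thesis .
qed

theorem proposition2p15:
  fixes M :: "'a measure" and X :: "nat \<Rightarrow> 'a \<Rightarrow> nat" and n :: nat
  assumes "n \<ge> 3"
    and "iid_die_rolls M X n"
  shows "E3 M X < \<infinity> \<and>
    complex_of_real (enn2real (E3 M X)) =
      of_nat n ^ n /
        (((of_nat n - 1) / 2 - (of_nat n + 1) / (2 * sqrt_neg3))
            * (of_nat n - 1 / 2 + sqrt_neg3 / 2) ^ (n - 1)
         + ((of_nat n - 1) / 2 + (of_nat n + 1) / (2 * sqrt_neg3))
            * (of_nat n - 1 / 2 - sqrt_neg3 / 2) ^ (n - 1))"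
proof -
  interpret prob_space M using assms(2) by (simp add: iid_die_rolls_def)
  interpret die_rolls M X n
    by unfold_locales (use assms in \<open>auto simp: iid_die_rolls_def\<close>)
  define D where "D = (\<Sum>k\<le>n. trisign k * (n choose k) / n ^ k)"
  have prod: "D * suminf survival = 1"
    unfolding D_def by (rule suminf_survival[OF assms(1)])
  have "0 \<le> suminf survival"
    using summable_survival[OF assms(1)] by (intro suminf_nonneg survival_nonneg)
  then have "complex_of_real (enn2real (E3 M X)) = of_real (suminf survival)"
    by (simp add: E3_eq_suminf_survival[OF assms(1)])
  also have "suminf survival = 1 / D"
    using prod by (metis mult_zero_left nonzero_eq_divide_eq mult.commute zero_neq_one)
  also have "complex_of_real (1 / D) = of_nat n ^ n / (of_nat n ^ n * complex_of_real D)"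
    using assms(1) by simp
  also have "of_nat n ^ n * complex_of_real D =
        ((of_nat n - 1) / 2 - (of_nat n + 1) / (2 * sqrt_neg3))
            * (of_nat n - 1 / 2 + sqrt_neg3 / 2) ^ (n - 1)
         + ((of_nat n - 1) / 2 + (of_nat n + 1) / (2 * sqrt_neg3))
            * (of_nat n - 1 / 2 - sqrt_neg3 / 2) ^ (n - 1)"
    unfolding D_def using assms(1) by (intro trisign_binomial_sum) simp
  finally show ?thesis by (simp add: E3_eq_suminf_survival[OF assms(1)])
qed

end
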